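(* For $r=1,\dots,d$ let $$\Sigma_r=\{\mu\in\mathbb{C}^{2d}:\ \operatorname{rank}\tilde M_d=r,\ \det M_r\neq 0\},\qquad \Sigma'_r=\{\mu\in\mathbb{C}^{2d}:\ \operatorname{rank}\tilde M_d=r,\ \det M_r= 0\}.$$ Then the set $\Sigma$ (respectively, $\Sigma'$) of those $\mu\in\mathbb{C}^{2d}$ for which the Prony problem of order $d$ with right-hand side $\mu$ is solvable (respectively, unsolvable) is the union $$\Sigma=\bigcup_{r=1}^{d}\Sigma_r\qquad\Bigl(\text{respectively, }\ \Sigma'=\bigcup_{r=1}^{d}\Sigma'_r\Bigr).$$ In particular, $\Sigma'\subset\{\mu\in\mathbb{C}^{2d}:\ \det M_d=0\}$.
   Context: Prony problem of order $d$ with right-hand side $\mu=(m_0,\dots,m_{2d-1})\in\mathbb{C}^{2d}$: find a number $s$, a multiplicity vector $D=(d_1,\dots,d_s)$ of positive integers with $\sum_{j=1}^s d_j\le d$, pairwise distinct nodes $x_1,\dots,x_s\in\mathbb{C}$, and coefficients $a_{j,\ell}\in\mathbb{C}$ ($1\le j\le s$, $0\le \ell\le d_j-1$) with $a_{j,d_j-1}\ne 0$ for every $j$, such that $$\sum_{j=1}^{s}\sum_{\ell=0}^{d_j-1}\frac{k!}{(k-\ell)!}\,a_{j,\ell}\,x_j^{k-\ell}=m_k,\qquad k=0,1,\dots,2d-1,$$ where terms with $\ell>k$ are read as $0$ and $x^0=1$. The problem is called solvable for $\mu$ if such data exist, and unsolvable otherwise. Hankel matrices associated with $\mu$: $\tilde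 M_d=(m_{i+j})_{0\le i\le d-1,\;0\le j\le d}$ is a $d\times(d+1)$ matrix, and for $1\le e\le d$, $M_e=(m_{i+j})_{0\le i,j\le e-1}$ is the $e\times e$ upper-left submatrix of $\tilde M_d$.
   Formalization: The zero vector has rank 0 and lies in no Σ_r or Σ'_r with r ≥ 1, so the stated unions miss it; here s = 0 is allowed, making μ = 0 solvable, and the first equality is proved as Σ = {0} ∪ ⋃_{r=1}^d Σ_r. *)

theory Defs
  imports "Jordan_Normal_Form.DL_Rank"
begin

text \<open>
  The data of a solution are the number of nodes \<open>s\<close>, the multiplicities \<open>D j\<close>, the nodes \<open>x j\<close>
  and the coefficients \<open>a j l\<close> for \<open>1 \<le> j \<le> s\<close> and \<open>0 \<le> l < D j\<close>; the values of the functions at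
  other arguments are irrelevant. The value \<open>s = 0\<close> is admitted: the empty system of nodes is the
  zero signal, which solves the problem exactly for the zero right-hand side.
\<close>

definition prony_solution ::
  "nat \<Rightarrow> complex vec \<Rightarrow> nat \<Rightarrow> (nat \<Rightarrow> nat) \<Rightarrow> (nat \<Rightarrow> complex) \<Rightarrow> (nat \<Rightarrow> nat \<Rightarrow> complex) \<Rightarrow> bool"
  where
  "prony_solution d \<mu> s D x a \<longleftrightarrow>
     (\<forall>j\<in>{1..s}. 0 < D j) \<and>
     (\<Sum>j=1..s. D j) \<le> d \<and>
     inj_on x {1..s} \<and>
     (\<forall>j\<in>{1..s}. a j (D j - 1) \<noteq> 0) \<and>
     (\<forall>k<2*d.
        (\<Sum>j=1..s. \<Sum>l<D j.
           if l \<le> k then fact k / fact (k - l) * a j l * x j ^ (k - l) else 0) = \<mu> $ k)"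

definition prony_solvable :: "nat \<Rightarrow> complex vec \<Rightarrow> bool" where
  "prony_solvable d \<mu> \<longleftrightarrow> (\<exists>s D x a. prony_solution d \<mu> s D x a)"

definition hankel_rect :: "nat \<Rightarrow> complex vec \<Rightarrow> complex mat" where
  "hankel_rect d \<mu> = mat d (d + 1) (\<lambda>(i, j). \<mu> $ (i + j))"

definition hankel_minor :: "nat \<Rightarrow> complex vec \<Rightarrow> complex mat" where
  "hankel_minor e \<mu> = mat e e (\<lambda>(i, j). \<mu> $ (i + j))"

definition Sigma_rank :: "nat \<Rightarrow> nat \<Rightarrow> complex vec set" where
  "Sigma_rank d r =
     {\<mu> \<in> carrier_vec (2*d). vec_space.rank d (hankel_rect d \<mu>) = r \<and> det (hankel_minor r \<mu>) \<noteq> 0}"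

definition Sigma'_rank :: "nat \<Rightarrow> nat \<Rightarrow> complex vec set" where
  "Sigma'_rank d r =
     {\<mu> \<in> carrier_vec (2*d). vec_space.rank d (hankel_rect d \<mu>) = r \<and> det (hankel_minor r \<mu>) = 0}"

definition solvable_set :: "nat \<Rightarrow> complex vec set" where
  "solvable_set d = {\<mu> \<in> carrier_vec (2*d). prony_solvable d \<mu>}"

definition unsolvable_set :: "nat \<Rightarrow> complex vec set" where
  "unsolvable_set d = {\<mu> \<in> carrier_vec (2*d). \<not> prony_solvable d \<mu>}"

end

theory Submission
  imports Defs "HOL-Computational_Algebra.Fundamental_Theorem_Algebra"
begin

text \<open>
  A right-hand side \<open>\<mu>\<close> is best viewed as the linear functional \<open>L\<close> with \<open>L(z\<^sup>k) = \<mu>\<^sub>k\<close> on polynomials of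
  degree less than \<open>2d\<close>, and both sides of the criterion turn out to speak about polynomials \<open>Q\<close> that
  annihilate \<open>L\<close>, that is, \<open>L(pQ) = 0\<close> for every multiple \<open>pQ\<close> in the domain of \<open>L\<close>.

  \<^emph>\<open>Solvability.\<close> The Prony equations express \<open>L\<close> as a combination of the functionals
  \<open>p \<mapsto> p\<^sup>(\<^sup>l\<^sup>)(x\<^sub>j)\<close> with \<open>l < d\<^sub>j\<close>. All of these vanish on the multiples of
  \<open>\<Prod>\<^sub>j (z - x\<^sub>j) ^ d\<^sub>j\<close>, so this product annihilates \<open>L\<close>. Conversely let a nonzero \<open>Q\<close> of degree at most \<open>d\<close>
  annihilate \<open>L\<close>. A polynomial at which the derivatives of order \<open>l < ord\<^sub>z Q\<close> vanish in every root \<open>z\<close>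
  of \<open>Q\<close> is a multiple of \<open>Q\<close>, so \<open>L\<close> vanishes on the common kernel of finitely many functionals and
  is therefore a combination of them; dropping top coefficients that are zero gives a solution
  (\<open>prony_solvable_iff_annihilator\<close>).

  \<^emph>\<open>Rank.\<close> Let \<open>Q\<close> be a nonzero annihilator of least degree \<open>e \<le> d\<close>. Division of \<open>z\<^sup>k\<close> by \<open>Q\<close> writes each column of
  the Hankel matrix in terms of its first \<open>e\<close> columns. A nonzero kernel vector of \<open>M\<^sub>e\<close> would be a polynomial
  of degree less than \<open>e\<close> and again an annihilator, so \<open>det M\<^sub>e \<noteq> 0\<close>, and \<open>e\<close> is the rank. Conversely, if
  \<open>r\<close> is the rank and \<open>det M\<^sub>r \<noteq> 0\<close>, then the columns \<open>r\<close> and \<open>d\<close> depend on the first \<open>r\<close> ones, which gives polynomials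
  \<open>Q\<close> of degree \<open>r\<close> and \<open>P\<close> of degree \<open>d\<close> that annihilate \<open>L\<close> against multipliers of degree less than \<open>d\<close>.
  Dividing an arbitrary multiplier of \<open>Q\<close> by \<open>P\<close> extends this to all of the required range
  (\<open>annihilator_exists_iff\<close>).

  Hence \<open>\<mu>\<close> is solvable exactly if \<open>det M\<^sub>r \<noteq> 0\<close> for the rank \<open>r\<close>. Rank zero means \<open>\<mu> = 0\<close>, where the
  empty determinant is one and the empty system of nodes is a solution.
\<close>

section \<open>Matrices with an invertible leading minor\<close>

context vec_space begin

context
  fixes A :: "'a mat" and m e :: nat
  assumes A: "A \<in> carrier_mat n m" and en: "e \<le> n" and em: "e \<le> m"
    and minor: "det (mat e e (\<lambda>(i, j). A $$ (i, j))) \<noteq> 0"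
begin

abbreviation (input) "first_cols \<equiv> mat n e (\<lambda>(i, j). A $$ (i, j))"

lemma first_cols_carrier: "first_cols \<in> carrier_mat n e"
  by simp

text \<open>
  The first \<open>e\<close> rows of the submatrix formed by the first \<open>e\<close> columns are the invertible minor.
\<close>

lemma first_cols_kernel:
  assumes v: "v \<in> carrier_vec e" and 0: "first_cols *\<^sub>v v = 0\<^sub>v n"
  shows "v = 0\<^sub>v e"
proof -
  have "mat e e (\<lambda>(i, j). A $$ (i, j)) *\<^sub>v v = 0\<^sub>v e"
  proof (rule eq_vecI)
    fix i assume "i < dim_vec (0\<^sub>v e :: 'a vec)"
    hence i: "i < e" by simp
    have "(first_cols *\<^sub>v v) $ i = 0" using i en 0 by simp
    thus "(mat e e (\<lambda>(i, j). A $$ (i, j)) *\<^sub>v v) $ i = 0\<^sub>v e $ i"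
      using i en v by (simp add: scalar_prod_def)
  qed simp
  thus ?thesis
    using det_0_iff_vec_prod_zero_field[of "mat e e (\<lambda>(i, j). A $$ (i, j))" e] minor v by auto
qed

text \<open>
  Sets of columns forget multiplicities; distinctness ensures that linear independence of the set
  of columns carries the same information as triviality of the kernel.
\<close>

lemma first_cols_distinct: "distinct (cols first_cols)"
proof (unfold distinct_conv_nth, intro allI impI notI)
  fix i j
  assume ij: "i < length (cols first_cols)" "j < length (cols first_cols)" "i \<noteq> j"
    and eq: "cols first_cols ! i = cols first_cols ! j"
  hence i: "i < e" and j: "j < e" by auto
  have *: "A $$ (k, i) = A $$ (k, j)" if "k < n" for k
    using arg_cong[OF eq, of "\<lambda>v. v $ k"] i j that by simp
  have "col (mat e e (\<lambda>(i, j). A $$ (i, j))) i = col (mat e e (\<lambda>(i, j). A $$ (i, j))) j"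
    by (rule eq_vecI) (use i j en * in auto)
  from det_identical_cols[OF _ ij(3) i j this] minor show False by simp
qed

lemma first_cols_indpt: "lin_indpt (set (cols first_cols))"
  using lin_depE[OF first_cols_carrier _ first_cols_distinct] first_cols_kernel by metis

lemma first_cols_card: "card (set (cols first_cols)) = e"
  using distinct_card[OF first_cols_distinct] by simp

lemma first_cols_subset: "set (cols first_cols) \<subseteq> set (cols A)"
proof
  fix v assume "v \<in> set (cols first_cols)"
  then obtain j where j: "j < e" "v = col first_cols j" by (auto simp: cols_def)
  have "v = col A j" using j A em by auto
  thus "v \<in> set (cols A)" using j A em by (auto simp: cols_def)
qed

lemma first_cols_span_iff:
  assumes v: "v \<in> carrier_vec n"
  shows "v \<in> span (set (cols first_cols)) \<longleftrightarrow>
           (\<exists>c. \<forall>i<n. v $ i = (\<Sum>j<e. c j * A $$ (i, j)))"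
proof -
  have sub: "set (cols first_cols) \<subseteq> carrier_vec n"
    using cols_dim[of first_cols] by simp
  have mult: "(first_cols *\<^sub>v vec e c) $ i = (\<Sum>j<e. c j * A $$ (i, j))" if "i < n" for c i
    using that by (simp add: scalar_prod_def lessThan_atLeast0 mult.commute)
  have "v \<in> span (set (cols first_cols)) \<longleftrightarrow> (\<exists>c. v = first_cols *\<^sub>v vec e c)"
  proof
    assume "v \<in> span (set (cols first_cols))"
    then obtain a where "lincomb a (set (cols first_cols)) = v"
      using finite_in_span[of "set (cols first_cols)" v] sub by auto
    hence "v = first_cols *\<^sub>v vec e (\<lambda>i. a (col first_cols i))"
      using mat_mult_eq_lincomb[OF first_cols_carrier first_cols_distinct] by simp
    thus "\<exists>c. v = first_cols *\<^sub>v vec e c" by (rule exI[of _ "\<lambda>i. a (col first_cols i)"])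
  next
    assume "\<exists>c. v = first_cols *\<^sub>v vec e c"
    then obtain c where c: "v = first_cols *\<^sub>v vec e c" by (rule exE)
    obtain a where "lincomb a (set (cols first_cols)) = v"
      using lincomb_eq_mat_mult[OF first_cols_carrier _ first_cols_distinct, of "vec e c"]
      unfolding c by simp
    thus "v \<in> span (set (cols first_cols))"
      using finite_span[of "set (cols first_cols)"] sub by auto
  qed
  also have "\<dots> \<longleftrightarrow> (\<exists>c. \<forall>i<n. v $ i = (\<Sum>j<e. c j * A $$ (i, j)))"
  proof (rule ex_cong1)
    fix c
    have "v = first_cols *\<^sub>v vec e c \<longleftrightarrow> (\<forall>i<n. v $ i = (first_cols *\<^sub>v vec e c) $ i)"
      using v by (simp add: vec_eq_iff)
    thus "v = first_cols *\<^sub>v vec e c \<longleftrightarrow> (\<forall>i<n. v $ i = (\<Sum>j<e. c j * A $$ (i, j)))"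
      using mult by simp
  qed
  finally show ?thesis .
qed

lemma rank_ge_minor: "e \<le> rank A"
  using rank_ge_card_indpt[OF A first_cols_subset first_cols_indpt] first_cols_card by simp

text \<open>
  The first \<open>e\<close> columns are linearly independent, so the rank is \<open>e\<close> exactly if they already form a
  maximal independent set of columns, which means that they span the column space.
\<close>

lemma rank_eq_minor_iff:
  "rank A = e \<longleftrightarrow> (\<forall>k<m. \<exists>c. \<forall>i<n. A $$ (i, k) = (\<Sum>j<e. c j * A $$ (i, j)))"
    (is "?l \<longleftrightarrow> ?r")
proof -
  let ?U = "set (cols first_cols)"
  have sub: "?U \<subseteq> carrier_vec n" using cols_dim[of first_cols] by simp
  have colsA: "set (cols A) \<subseteq> carrier_vec n" using cols_dim[of A] A by simp
  have "?r \<longleftrightarrow> (\<forall>k<m. col A k \<in> span ?U)"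
  proof -
    have "(col A k \<in> span ?U) \<longleftrightarrow> (\<exists>c. \<forall>i<n. A $$ (i, k) = (\<Sum>j<e. c j * A $$ (i, j)))"
      if "k < m" for k
      using A that by (subst first_cols_span_iff) auto
    thus ?thesis by blast
  qed
  also have "\<dots> \<longleftrightarrow> set (cols A) \<subseteq> span ?U"
    using A by (fastforce simp: cols_def)
  also have "\<dots> \<longleftrightarrow> ?l"
  proof
    assume span: "set (cols A) \<subseteq> span ?U"
    have "maximal ?U (\<lambda>T. T \<subseteq> set (cols A) \<and> lin_indpt T)"
      unfolding maximal_def
    proof (intro conjI allI impI first_cols_subset first_cols_indpt)
      fix T assume T: "?U \<subseteq> T \<and> T \<subseteq> set (cols A) \<and> lin_indpt T"
      show "T = ?U"
      proof (rule ccontr)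
        assume "T \<noteq> ?U"
        then obtain v where v: "v \<in> T" "v \<notin> ?U" using T by blast
        hence "lin_dep (?U \<union> {v})"
          using lin_dep_iff_in_span[of ?U v] sub first_cols_indpt colsA T span by auto
        thus False using subset_li_is_li[of T "?U \<union> {v}"] T v by auto
      qed
    qed
    from rank_card_indpt[OF A this] first_cols_card show ?l by simp
  next
    assume l: ?l
    show "set (cols A) \<subseteq> span ?U"
    proof
      fix v assume v: "v \<in> set (cols A)"
      show "v \<in> span ?U"
      proof (cases "v \<in> ?U")
        case True thus ?thesis using sub in_own_span by auto
      next
        case False
        show ?thesis
        proof (rule ccontr)
          assume "v \<notin> span ?U"
          hence "lin_indpt (?U \<union> {v})"
            using lin_dep_iff_in_span[of ?U v] sub first_cols_indpt colsA False v by auto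
          hence "card (?U \<union> {v}) \<le> rank A"
            using rank_ge_card_indpt[OF A] first_cols_subset v by auto
          thus False using False l first_cols_card by simp
        qed
      qed
    qed
  qed
  finally show ?thesis by simp
qed

end

end

lemma (in vec_space) rank_le_rows:
  assumes A: "A \<in> carrier_mat n m"
  shows "rank A \<le> n"
proof -
  have "lin_indpt {}" by (simp add: lin_dep_def)
  then obtain S where S: "maximal S (\<lambda>T. T \<subseteq> set (cols A) \<and> lin_indpt T)"
    using maximal_exists_superset[of "set (cols A)" "\<lambda>T. T \<subseteq> set (cols A) \<and> lin_indpt T" "{}"] by auto
  hence "S \<subseteq> carrier_vec n" "lin_indpt S"
    using cols_dim[of A] A by (auto simp: maximal_def)
  hence "card S \<le> n" using li_le_dim(2)[OF fin_dim] dim_is_n by simp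
  thus ?thesis using rank_card_indpt[OF A S] by simp
qed

section \<open>The moment functional and its annihilators\<close>

definition moment_functional :: "complex vec \<Rightarrow> complex poly \<Rightarrow> complex" where
  "moment_functional \<mu> p = (\<Sum>k<dim_vec \<mu>. coeff p k * \<mu> $ k)"

lemma moment_functional_0 [simp]: "moment_functional \<mu> 0 = 0"
  by (simp add: moment_functional_def)

lemma moment_functional_add:
  "moment_functional \<mu> (p + q) = moment_functional \<mu> p + moment_functional \<mu> q"
  by (simp add: moment_functional_def sum.distrib algebra_simps)

lemma moment_functional_diff:
  "moment_functional \<mu> (p - q) = moment_functional \<mu> p - moment_functional \<mu> q"
  by (simp add: moment_functional_def sum_subtractf algebra_simps)

lemma moment_functional_smult:
  "moment_functional \<mu> (Polynomial.smult c p) = c * moment_functional \<mu> p"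
  by (simp add: moment_functional_def sum_distrib_left algebra_simps)

lemma moment_functional_sum:
  "moment_functional \<mu> (\<Sum>i\<in>I. f i) = (\<Sum>i\<in>I. moment_functional \<mu> (f i))"
  by (induction I rule: infinite_finite_induct) (auto simp: moment_functional_add)

lemma moment_functional_monom:
  "k < dim_vec \<mu> \<Longrightarrow> moment_functional \<mu> (monom c k) = c * \<mu> $ k"
  by (simp add: moment_functional_def coeff_monom if_distrib[of "\<lambda>x. x * _"] cong: if_cong)

lemma poly_eq_sum_monom:
  assumes "\<And>j. j \<ge> e \<Longrightarrow> coeff p j = 0"
  shows "p = (\<Sum>j<e. monom (coeff p j) j)"
  using assms by (intro poly_eqI) (auto simp: coeff_sum not_less)

text \<open>
  The connection between the functional and Hankel matrices: if \<open>p\<close> is read as a vector of coefficients,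
  the right-hand side is entry \<open>i\<close> of the product of a Hankel matrix with \<open>e\<close> columns and \<open>p\<close>.
\<close>

lemma moment_functional_shift:
  assumes "\<And>j. j \<ge> e \<Longrightarrow> coeff p j = 0" and "i + e \<le> dim_vec \<mu>"
  shows "moment_functional \<mu> (monom 1 i * p) = (\<Sum>j<e. coeff p j * \<mu> $ (i + j))"
proof -
  have "monom 1 i * p = (\<Sum>j<e. monom (coeff p j) (i + j))"
    by (subst poly_eq_sum_monom[OF assms(1)]) (simp_all add: sum_distrib_left mult_monom)
  thus ?thesis
    using assms(2) by (simp add: moment_functional_sum moment_functional_monom)
qed

lemma moment_functional_mult_eq_0:
  assumes "\<And>i. i < n \<Longrightarrow> moment_functional \<mu> (monom 1 i * p) = 0" and "s = 0 \<or> degree s < n"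
  shows "moment_functional \<mu> (s * p) = 0"
proof -
  have "s = (\<Sum>i<n. monom (coeff s i) i)"
    using assms(2) by (intro poly_eq_sum_monom) (auto intro: coeff_eq_0)
  hence "s * p = (\<Sum>i<n. monom (coeff s i) i) * p" by simp
  also have "\<dots> = (\<Sum>i<n. Polynomial.smult (coeff s i) (monom 1 i * p))"
    unfolding sum_distrib_right
    by (intro sum.cong) (simp_all flip: mult_smult_left add: smult_monom)
  finally show ?thesis
    using assms(1) by (simp add: moment_functional_sum moment_functional_smult)
qed

text \<open>
  The bound on the degree confines the condition to polynomials on which the moments determine the
  functional; without it the truncation in \<^const>\<open>moment_functional\<close> would impose spurious equations.
\<close>

definition annihilates :: "complex vec \<Rightarrow> complex poly \<Rightarrow> bool" where
  "annihilates \<mu> Q \<longleftrightarrow>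
     (\<forall>p. degree (p * Q) < dim_vec \<mu> \<longrightarrow> moment_functional \<mu> (p * Q) = 0)"

section \<open>Annihilators and the rank of the Hankel matrix\<close>

lemma degree_div_mult_le:
  fixes s Q :: "'a::field poly"
  assumes "Q \<noteq> 0"
  shows "degree (s div Q * Q) \<le> degree s"
proof (cases "degree s < degree Q")
  case True
  thus ?thesis by (simp add: div_poly_less)
next
  case False
  have "s div Q * Q = s - s mod Q" by (simp add: minus_mod_eq_div_mult)
  moreover have "degree (s mod Q) \<le> degree s"
    using degree_mod_less[OF assms, of s] False by auto
  ultimately show ?thesis by (simp add: degree_diff_le)
qed

lemma hankel_minor_eq:
  "e \<le> d \<Longrightarrow> hankel_minor e \<mu> = mat e e (\<lambda>(i, j). hankel_rect d \<mu> $$ (i, j))"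
  by (rule eq_matI) (auto simp: hankel_minor_def hankel_rect_def)

text \<open>
  Column \<open>k\<close> of the Hankel matrix consists of the moments \<open>\<mu>\<^sub>i\<^sub>+\<^sub>k\<close>, so this reads the rank criterion
  as the existence of linear recurrences.
\<close>

lemma rank_hankel_eq_iff:
  assumes "e \<le> d" "det (hankel_minor e \<mu>) \<noteq> 0"
  shows "vec_space.rank d (hankel_rect d \<mu>) = e \<longleftrightarrow>
           (\<forall>k\<le>d. \<exists>c. \<forall>i<d. \<mu> $ (i + k) = (\<Sum>j<e. c j * \<mu> $ (i + j)))"
proof -
  have A: "hankel_rect d \<mu> \<in> carrier_mat d (d + 1)" by (simp add: hankel_rect_def)
  have det: "det (mat e e (\<lambda>(i, j). hankel_rect d \<mu> $$ (i, j))) \<noteq> 0"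
    using assms hankel_minor_eq by metis
  have "vec_space.rank d (hankel_rect d \<mu>) = e \<longleftrightarrow> (\<forall>k<d+1. \<exists>c. \<forall>i<d.
     hankel_rect d \<mu> $$ (i, k) = (\<Sum>j<e. c j * hankel_rect d \<mu> $$ (i, j)))"
    by (rule vec_space.rank_eq_minor_iff[OF A _ _ det]) (use assms in auto)
  also have "\<dots> \<longleftrightarrow> (\<forall>k\<le>d. \<exists>c. \<forall>i<d. \<mu> $ (i + k) = (\<Sum>j<e. c j * \<mu> $ (i + j)))"
    using assms(1) by (auto simp: hankel_rect_def less_Suc_eq_le)
  finally show ?thesis .
qed

lemma rank_hankel_ge:
  assumes "e \<le> d" "det (hankel_minor e \<mu>) \<noteq> 0"
  shows "e \<le> vec_space.rank d (hankel_rect d \<mu>)"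
proof (rule vec_space.rank_ge_minor)
  show "hankel_rect d \<mu> \<in> carrier_mat d (d + 1)" by (simp add: hankel_rect_def)
  show "det (mat e e (\<lambda>(i, j). hankel_rect d \<mu> $$ (i, j))) \<noteq> 0"
    using assms hankel_minor_eq by metis
qed (use assms in auto)

lemma rank_hankel_le: "vec_space.rank d (hankel_rect d \<mu>) \<le> d"
  by (rule vec_space.rank_le_rows[of _ _ "d + 1"]) (simp add: hankel_rect_def)

text \<open>
  Every moment is an entry of the rectangular matrix: with \<open>i < d\<close> and \<open>k \<le> d\<close>, the sum \<open>i + k\<close> runs
  through all indices up to \<open>2d - 1\<close>.
\<close>

lemma rank_hankel_0_iff:
  assumes \<mu>: "\<mu> \<in> carrier_vec (2 * d)"
  shows "vec_space.rank d (hankel_rect d \<mu>) = 0 \<longleftrightarrow> \<mu> = 0\<^sub>v (2 * d)"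
proof -
  have "det (hankel_minor 0 \<mu>) \<noteq> 0" by (simp add: hankel_minor_def)
  hence "vec_space.rank d (hankel_rect d \<mu>) = 0 \<longleftrightarrow> (\<forall>k\<le>d. \<forall>i<d. \<mu> $ (i + k) = 0)"
    using rank_hankel_eq_iff[of 0 d \<mu>] by simp
  also have "\<dots> \<longleftrightarrow> (\<forall>n<2*d. \<mu> $ n = 0)"
  proof (intro iffI allI impI)
    fix n assume *: "\<forall>k\<le>d. \<forall>i<d. \<mu> $ (i + k) = 0" and n: "n < 2 * d"
    show "\<mu> $ n = 0"
    proof (cases "n < d")
      case True thus ?thesis using *[rule_format, of 0 n] by simp
    next
      case False
      thus ?thesis using *[rule_format, of "n - (d - 1)" "d - 1"] n by simp
    qed
  qed simp
  also have "\<dots> \<longleftrightarrow> \<mu> = 0\<^sub>v (2 * d)"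
    using \<mu> by (auto simp: vec_eq_iff)
  finally show ?thesis .
qed

text \<open>
  A nonzero kernel vector of the minor is a polynomial \<open>p\<close> of degree less than \<open>e = deg Q\<close> with \<open>L(z\<^sup>i p) = 0\<close>
  for \<open>i < e\<close>. Reducing a multiplier of \<open>p\<close> modulo \<open>Q\<close> brings its degree below \<open>e\<close>, so \<open>p\<close> is itself an
  annihilator, contrary to the minimality of \<open>Q\<close>.
\<close>

lemma det_minor_of_minimal_annihilator:
  assumes dim: "dim_vec \<mu> = 2 * d" and Q: "Q \<noteq> 0" "degree Q \<le> d" "annihilates \<mu> Q"
    and min: "\<And>P. P \<noteq> 0 \<Longrightarrow> annihilates \<mu> P \<Longrightarrow> degree Q \<le> degree P"
  shows "det (hankel_minor (degree Q) \<mu>) \<noteq> 0"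
proof
  define e where "e = degree Q"
  assume "det (hankel_minor (degree Q) \<mu>) = 0"
  then obtain v where v: "v \<in> carrier_vec e" "v \<noteq> 0\<^sub>v e" "hankel_minor e \<mu> *\<^sub>v v = 0\<^sub>v e"
    using det_0_iff_vec_prod_zero_field[of "hankel_minor e \<mu>" e]
    by (auto simp: hankel_minor_def e_def)
  define p where "p = (\<Sum>j<e. monom (v $ j) j)"
  have coeff_p: "coeff p j = (if j < e then v $ j else 0)" for j
    by (simp add: p_def coeff_sum)
  obtain j where j: "j < e" "v $ j \<noteq> 0"
    using v(1,2) by (auto simp: vec_eq_iff)
  hence p0: "p \<noteq> 0" using coeff_p[of j] by auto
  hence deg_p: "degree p < e"
    using coeff_p[of "degree p"] by (auto split: if_splits)
  have low: "moment_functional \<mu> (monom 1 i * p) = 0" if i: "i < e" for i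
  proof -
    have "moment_functional \<mu> (monom 1 i * p) = (\<Sum>j<e. coeff p j * \<mu> $ (i + j))"
      by (rule moment_functional_shift) (use i Q dim coeff_p in \<open>auto simp: e_def\<close>)
    also have "\<dots> = (hankel_minor e \<mu> *\<^sub>v v) $ i"
      using i v(1) coeff_p
      by (simp add: hankel_minor_def scalar_prod_def lessThan_atLeast0 mult.commute)
    finally show ?thesis using v(3) i by simp
  qed
  have "annihilates \<mu> p"
    unfolding annihilates_def
  proof (intro allI impI)
    fix s assume deg: "degree (s * p) < dim_vec \<mu>"
    have "s * p = s div Q * p * Q + s mod Q * p"
      by (metis (no_types, lifting) div_mult_mod_eq distrib_right mult.assoc mult.commute)
    moreover have "moment_functional \<mu> (s div Q * p * Q) = 0"
    proof (cases "s div Q = 0")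
      case False
      hence "s \<noteq> 0" by auto
      have "degree (s div Q * p * Q) = degree (s div Q * Q) + degree p"
        using False Q(1) p0 by (simp add: degree_mult_eq)
      also have "\<dots> \<le> degree (s * p)"
        using degree_div_mult_le[OF Q(1), of s] \<open>s \<noteq> 0\<close> p0 by (simp add: degree_mult_eq)
      finally show ?thesis using Q(3) deg by (simp add: annihilates_def)
    qed simp
    moreover have "moment_functional \<mu> (s mod Q * p) = 0"
      by (rule moment_functional_mult_eq_0[OF low])
        (use degree_mod_less[OF Q(1), of s] in \<open>auto simp: e_def\<close>)
    ultimately show "moment_functional \<mu> (s * p) = 0"
      by (simp add: moment_functional_add)
  qed
  with min[OF p0] deg_p show False by (simp add: e_def)
qed

text \<open>
  The remainder of \<open>z\<^sup>k\<close> modulo \<open>Q\<close> has degree less than \<open>deg Q\<close>, and its coefficients express column \<open>k\<close>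
  in terms of the preceding ones.
\<close>

lemma hankel_columns_of_annihilator:
  assumes dim: "dim_vec \<mu> = 2 * d" and Q: "Q \<noteq> 0" "degree Q \<le> d" "annihilates \<mu> Q"
    and k: "k \<le> d"
  shows "\<exists>c. \<forall>i<d. \<mu> $ (i + k) = (\<Sum>j<degree Q. c j * \<mu> $ (i + j))"
proof (intro exI allI impI)
  fix i assume i: "i < d"
  let ?z = "monom (1::complex) k"
  have coeff_r: "coeff (?z mod Q) j = 0" if "j \<ge> degree Q" for j
    using degree_mod_less[OF Q(1), of ?z] that by (auto intro: coeff_eq_0)
  have "\<mu> $ (i + k) = moment_functional \<mu> (monom 1 i * ?z)"
    using i k dim by (simp add: mult_monom moment_functional_monom)
  also have "monom 1 i * ?z = monom 1 i * (?z div Q) * Q + monom 1 i * (?z mod Q)"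
    by (metis (no_types, lifting) div_mult_mod_eq distrib_left mult.assoc)
  also have "moment_functional \<mu> \<dots> = moment_functional \<mu> (monom 1 i * (?z mod Q))"
  proof -
    have "degree (monom 1 i * (?z div Q) * Q) \<le> degree (monom (1::complex) i) + degree (?z div Q * Q)"
      unfolding mult.assoc by (rule degree_mult_le)
    also have "\<dots> \<le> i + k"
      using degree_div_mult_le[OF Q(1), of ?z] by (simp add: degree_monom_eq)
    finally show ?thesis
      using Q(3) i k dim by (simp add: annihilates_def moment_functional_add)
  qed
  also have "\<dots> = (\<Sum>j<degree Q. coeff (?z mod Q) j * \<mu> $ (i + j))"
    by (rule moment_functional_shift) (use coeff_r i Q dim in auto)
  finally show "\<mu> $ (i + k) = (\<Sum>j<degree Q. coeff (?z mod Q) j * \<mu> $ (i + j))" .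
qed

text \<open>
  The relation for column \<open>k\<close> is encoded by the polynomial \<open>z\<^sup>k - \<Sum>\<^sub>j c\<^sub>j z\<^sup>j\<close>.
\<close>

lemma column_relation_polynomial:
  assumes dim: "dim_vec \<mu> = 2 * d" and "r \<le> k" "k \<le> d"
    and c: "\<forall>i<d. \<mu> $ (i + k) = (\<Sum>j<r. c j * \<mu> $ (i + j))"
  obtains P where "P \<noteq> 0" "degree P = k"
    "\<And>i. i < d \<Longrightarrow> moment_functional \<mu> (monom 1 i * P) = 0"
proof
  define R where "R = (\<Sum>j<r. monom (c j) j)"
  have coeff_R: "coeff R j = (if j < r then c j else 0)" for j
    by (simp add: R_def coeff_sum)
  have coeff_P: "coeff (monom 1 k - R) k = 1"
    using assms(2) by (simp add: coeff_R)
  show "monom 1 k - R \<noteq> 0"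
    using coeff_P by auto
  show "degree (monom 1 k - R) = k"
    using coeff_P assms(2)
    by (intro antisym degree_le le_degree) (auto simp: coeff_R)
  show "moment_functional \<mu> (monom 1 i * (monom 1 k - R)) = 0" if i: "i < d" for i
  proof -
    have "moment_functional \<mu> (monom 1 i * R) = (\<Sum>j<r. coeff R j * \<mu> $ (i + j))"
      by (rule moment_functional_shift) (use i assms dim coeff_R in auto)
    also have "\<dots> = \<mu> $ (i + k)" using c i by (simp add: coeff_R)
    also have "\<dots> = moment_functional \<mu> (monom 1 i * monom 1 k)"
      using i assms dim by (simp add: mult_monom moment_functional_monom)
    finally show ?thesis
      by (simp add: right_diff_distrib moment_functional_diff)
  qed
qed

text \<open>
  The relation for column \<open>r\<close> gives a polynomial \<open>Q\<close> of degree \<open>r\<close> with \<open>L(z\<^sup>i Q) = 0\<close> only for \<open>i < d\<close>, whereas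
  an annihilator needs this for \<open>i < 2d - r\<close>. The missing range comes from the last column, which gives a polynomial
  \<open>P\<close> of degree \<open>d\<close>: writing a multiplier as \<open>t P + B\<close> with \<open>deg B < d\<close>, the part \<open>B\<close> is covered
  by \<open>Q\<close>, while \<open>t Q\<close> has degree less than \<open>d\<close> and is covered by \<open>P\<close>.
\<close>

lemma annihilator_of_hankel_columns:
  assumes dim: "dim_vec \<mu> = 2 * d" and r: "r \<le> d"
    and cols: "\<forall>k\<le>d. \<exists>c. \<forall>i<d. \<mu> $ (i + k) = (\<Sum>j<r. c j * \<mu> $ (i + j))"
  shows "\<exists>Q. Q \<noteq> 0 \<and> degree Q = r \<and> annihilates \<mu> Q"
proof -
  obtain P where P: "P \<noteq> 0" "degree P = d"
    "\<And>i. i < d \<Longrightarrow> moment_functional \<mu> (monom 1 i * P) = 0"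
    using cols column_relation_polynomial[OF dim r order_refl] by blast
  obtain Q where Q: "Q \<noteq> 0" "degree Q = r"
    "\<And>i. i < d \<Longrightarrow> moment_functional \<mu> (monom 1 i * Q) = 0"
    using cols r column_relation_polynomial[OF dim order_refl r] by blast
  have "annihilates \<mu> Q"
    unfolding annihilates_def
  proof (intro allI impI)
    fix s assume deg: "degree (s * Q) < dim_vec \<mu>"
    have "s * Q = s div P * Q * P + s mod P * Q"
      by (metis (no_types, lifting) div_mult_mod_eq distrib_right mult.assoc mult.commute)
    moreover have "moment_functional \<mu> (s div P * Q * P) = 0"
    proof (rule moment_functional_mult_eq_0[OF P(3)])
      show "s div P * Q = 0 \<or> degree (s div P * Q) < d"
      proof (cases "s div P = 0")
        case False
        hence "s \<noteq> 0" by auto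
        \<comment> \<open>Since \<open>deg s < 2d - r\<close>, the quotient has degree less than \<open>d - r\<close>.\<close>
        have "degree (s div P) + d \<le> degree s"
          using degree_div_mult_le[OF P(1), of s] False P by (simp add: degree_mult_eq)
        moreover have "degree s + r < 2 * d"
          using deg dim \<open>s \<noteq> 0\<close> Q by (simp add: degree_mult_eq)
        ultimately show ?thesis using False Q by (simp add: degree_mult_eq)
      qed simp
    qed
    moreover have "moment_functional \<mu> (s mod P * Q) = 0"
      by (rule moment_functional_mult_eq_0[OF Q(3)])
        (use degree_mod_less[OF P(1), of s] P(2) in auto)
    ultimately show "moment_functional \<mu> (s * Q) = 0"
      by (simp add: moment_functional_add)
  qed
  with Q show ?thesis by blast
qed

text \<open>
  If there is an annihilator of degree at most \<open>d\<close>, one of least degree \<open>e\<close> makes the minor of size \<open>e\<close>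
  invertible and the first \<open>e\<close> columns spanning, which identifies \<open>e\<close> with the rank. Conversely an
  invertible minor of the size of the rank makes the first columns spanning, and their relations
  yield an annihilator.
\<close>

theorem annihilator_exists_iff:
  assumes dim: "dim_vec \<mu> = 2 * d" and rank: "vec_space.rank d (hankel_rect d \<mu>) = r" "r \<le> d"
  shows "(\<exists>Q. Q \<noteq> 0 \<and> degree Q \<le> d \<and> annihilates \<mu> Q) \<longleftrightarrow> det (hankel_minor r \<mu>) \<noteq> 0"
proof
  assume "\<exists>Q. Q \<noteq> 0 \<and> degree Q \<le> d \<and> annihilates \<mu> Q"
  then obtain Q0 where Q0: "Q0 \<noteq> 0 \<and> annihilates \<mu> Q0" "degree Q0 \<le> d" by blast
  define Q where "Q = arg_min degree (\<lambda>Q. Q \<noteq> 0 \<and> annihilates \<mu> Q)"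
  have Q: "Q \<noteq> 0" "annihilates \<mu> Q"
    using arg_min_nat_lemma[of "\<lambda>Q. Q \<noteq> 0 \<and> annihilates \<mu> Q", OF Q0(1), of degree]
    by (auto simp: Q_def)
  have min: "degree Q \<le> degree P" if "P \<noteq> 0 \<and> annihilates \<mu> P" for P
    using arg_min_nat_lemma[of "\<lambda>Q. Q \<noteq> 0 \<and> annihilates \<mu> Q", OF Q0(1), of degree] that
    by (auto simp: Q_def)
  have deg: "degree Q \<le> d" using min[OF Q0(1)] Q0(2) by simp
  have det: "det (hankel_minor (degree Q) \<mu>) \<noteq> 0"
    using det_minor_of_minimal_annihilator[OF dim Q(1) deg Q(2)] min by blast
  have "\<forall>k\<le>d. \<exists>c. \<forall>i<d. \<mu> $ (i + k) = (\<Sum>j<degree Q. c j * \<mu> $ (i + j))"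
  proof (intro allI impI)
    fix k assume "k \<le> d"
    thus "\<exists>c. \<forall>i<d. \<mu> $ (i + k) = (\<Sum>j<degree Q. c j * \<mu> $ (i + j))"
      by (rule hankel_columns_of_annihilator[OF dim Q(1) deg Q(2)])
  qed
  hence "vec_space.rank d (hankel_rect d \<mu>) = degree Q"
    by (rule rank_hankel_eq_iff[OF deg det, THEN iffD2])
  with det rank(1) show "det (hankel_minor r \<mu>) \<noteq> 0" by metis
next
  assume det: "det (hankel_minor r \<mu>) \<noteq> 0"
  have "\<forall>k\<le>d. \<exists>c. \<forall>i<d. \<mu> $ (i + k) = (\<Sum>j<r. c j * \<mu> $ (i + j))"
    by (rule rank_hankel_eq_iff[OF rank(2) det, THEN iffD1]) (rule rank(1))
  from annihilator_of_hankel_columns[OF dim rank(2) this] rank(2)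
  show "\<exists>Q. Q \<noteq> 0 \<and> degree Q \<le> d \<and> annihilates \<mu> Q" by auto
qed

section \<open>Solutions of the Prony problem and annihilators\<close>

text \<open>
  The coefficients of the Prony equations are values of derivatives of monomials.
\<close>

lemma poly_higher_pderiv_monom:
  fixes x :: "'a::field_char_0"
  shows "poly ((pderiv ^^ l) (monom 1 k)) x =
           (if l \<le> k then fact k / fact (k - l) * x ^ (k - l) else 0)"
proof -
  have "(pderiv ^^ l) (monom (1::'a) k) =
          (if l \<le> k then monom (fact k / fact (k - l)) (k - l) else 0)"
  proof (induction l)
    case (Suc l)
    show ?case
    proof (cases "Suc l \<le> k")
      case True
      then obtain m where m: "k - l = Suc m" by (metis Suc_diff_le diff_Suc_Suc)
      hence m': "k - Suc l = m" by simp
      have "of_nat (Suc m) * (fact k / fact (Suc m)) = (fact k / fact m :: 'a)"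
        by (simp add: fact_Suc field_simps del: of_nat_Suc)
      thus ?thesis using Suc True m m' by (simp add: pderiv_monom del: of_nat_Suc fact_Suc)
    next
      case False
      thus ?thesis using Suc by (auto simp: pderiv_monom)
    qed
  qed simp
  thus ?thesis by (simp add: poly_monom)
qed

text \<open>
  In characteristic zero, differentiation lowers the order of a root by exactly one.
\<close>

lemma linear_power_dvd_iff_derivatives_vanish:
  fixes p :: "'a::field_char_0 poly"
  shows "[:-x, 1:] ^ n dvd p \<longleftrightarrow> (\<forall>l<n. poly ((pderiv ^^ l) p) x = 0)"
proof (induction n arbitrary: p)
  case (Suc n)
  have split: "(\<forall>l<Suc n. poly ((pderiv ^^ l) p) x = 0) \<longleftrightarrow>
          poly p x = 0 \<and> (\<forall>l<n. poly ((pderiv ^^ l) (pderiv p)) x = 0)"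
    by (simp add: All_less_Suc2 funpow_swap1)
  show ?case
  proof (cases "p = 0 \<or> poly p x \<noteq> 0")
    case True
    thus ?thesis
    proof
      assume "p = 0" thus ?thesis by (simp add: higher_pderiv_0)
    next
      assume "poly p x \<noteq> 0"
      thus ?thesis unfolding split by (metis dvd_power dvd_trans poly_eq_0_iff_dvd zero_less_Suc)
    qed
  next
    case False
    hence p: "p \<noteq> 0" "poly p x = 0" by auto
    have "pderiv p \<noteq> 0"
    proof
      assume "pderiv p = 0"
      then obtain c where "p = [:c:]" by (metis pderiv_eq_0_iff degree_0_id)
      with p show False by simp
    qed
    hence "[:-x, 1:] ^ Suc n dvd p \<longleftrightarrow> [:-x, 1:] ^ n dvd pderiv p"
      unfolding order_divides using p order_pderiv[OF p] by simp
    thus ?thesis unfolding split Suc.IH using p by simp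
  qed
qed simp

text \<open>
  This plays the role of the invertibility of confluent Vandermonde matrices. By induction on the
  number of functionals: if \<open>f\<^sub>i\<close> is nonzero at some \<open>v\<close> in the common kernel of the others, subtracting
  \<open>(g v / f\<^sub>i v) f\<^sub>i\<close> from \<open>g\<close> makes it vanish on that common kernel; otherwise the common
  kernel of the others has the same property as the full one.
\<close>

lemma functional_combination_of_common_kernel:
  fixes f :: "'i \<Rightarrow> 'v::ab_group_add \<Rightarrow> 'k::field" and scale :: "'k \<Rightarrow> 'v \<Rightarrow> 'v"
  assumes "finite I"
    and U: "\<And>u w c. u \<in> U \<Longrightarrow> w \<in> U \<Longrightarrow> w + scale c u \<in> U"
    and f: "\<And>i u w c. f i (w + scale c u) = f i w + c * f i u"
    and g: "\<And>u w c. g (w + scale c u) = g w + c * g u"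
    and ker: "\<And>w. w \<in> U \<Longrightarrow> (\<And>i. i \<in> I \<Longrightarrow> f i w = 0) \<Longrightarrow> g w = 0"
  shows "\<exists>c. \<forall>w\<in>U. g w = (\<Sum>i\<in>I. c i * f i w)"
  using assms(1) g ker
proof (induction I arbitrary: g rule: finite_induct)
  case empty
  thus ?case by simp
next
  case (insert i I)
  show ?case
  proof (cases "\<exists>v\<in>U. (\<forall>j\<in>I. f j v = 0) \<and> f i v \<noteq> 0")
    case True
    then obtain v where v: "v \<in> U" "\<And>j. j \<in> I \<Longrightarrow> f j v = 0" "f i v \<noteq> 0" by blast
    \<comment> \<open>The multiple of the new functional that makes the difference vanish at \<open>v\<close>.\<close>
    define b where "b = g v / f i v"
    have "\<exists>c. \<forall>w\<in>U. g w - b * f i w = (\<Sum>j\<in>I. c j * f j w)"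
    proof (rule insert.IH)
      show "g (w + scale c u) - b * f i (w + scale c u) = g w - b * f i w + c * (g u - b * f i u)"
        for w u c by (simp add: insert.prems(1) f algebra_simps)
      show "g w - b * f i w = 0" if w: "w \<in> U" "\<And>j. j \<in> I \<Longrightarrow> f j w = 0" for w
      proof -
        \<comment> \<open>Shifting \<open>w\<close> along \<open>v\<close> annuls \<open>f i\<close> and leaves the other functionals zero.\<close>
        have "g (w + scale (- (f i w / f i v)) v) = 0"
          by (rule insert.prems(2)) (use v w U in \<open>auto simp: f\<close>)
        thus ?thesis by (simp add: insert.prems(1) b_def)
      qed
    qed
    then obtain c where c: "\<forall>w\<in>U. g w - b * f i w = (\<Sum>j\<in>I. c j * f j w)" ..
    show ?thesis
    proof (intro exI ballI)
      fix w assume "w \<in> U"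
      have "(\<Sum>j\<in>insert i I. (c(i := b)) j * f j w) = b * f i w + (\<Sum>j\<in>I. c j * f j w)"
        using insert.hyps by (simp, intro sum.cong) auto
      thus "g w = (\<Sum>j\<in>insert i I. (c(i := b)) j * f j w)"
        using c \<open>w \<in> U\<close> by (metis add_diff_cancel_left' diff_add_cancel add.commute)
    qed
  next
    case False
    have "\<exists>c. \<forall>w\<in>U. g w = (\<Sum>j\<in>I. c j * f j w)"
    proof (rule insert.IH)
      show "g w = 0" if "w \<in> U" "\<And>j. j \<in> I \<Longrightarrow> f j w = 0" for w
        using insert.prems(2)[OF that(1)] that False by blast
    qed (rule insert.prems(1))
    then obtain c where c: "\<forall>w\<in>U. g w = (\<Sum>j\<in>I. c j * f j w)" ..
    show ?thesis
    proof (intro exI ballI)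
      fix w assume "w \<in> U"
      have "(\<Sum>j\<in>insert i I. (c(i := 0)) j * f j w) = (\<Sum>j\<in>I. c j * f j w)"
        using insert.hyps by (simp, intro sum.cong) auto
      thus "g w = (\<Sum>j\<in>insert i I. (c(i := 0)) j * f j w)"
        using c \<open>w \<in> U\<close> by simp
    qed
  qed
qed

lemma complex_poly_dvdI_order:
  fixes p q :: "complex poly"
  assumes "q \<noteq> 0" and le: "\<And>z. poly q z = 0 \<Longrightarrow> [:-z, 1:] ^ Polynomial.order z q dvd p"
  shows "q dvd p"
proof (cases "p = 0")
  case False
  have ord: "Polynomial.order z q \<le> Polynomial.order z p" if "poly q z = 0" for z
    using le[OF that] False by (simp add: order_divides)
  have "(\<Prod>z|poly q z = 0. [:-z, 1:] ^ Polynomial.order z q) dvd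
        (\<Prod>z|poly p z = 0. [:-z, 1:] ^ Polynomial.order z p)"
  proof (rule prod_dvd_prod_subset2)
    show "finite {z. poly p z = 0}" using False by (rule poly_roots_finite)
    show "{z. poly q z = 0} \<subseteq> {z. poly p z = 0}"
    proof
      fix z assume "z \<in> {z. poly q z = 0}"
      hence "0 < Polynomial.order z q" "Polynomial.order z q \<le> Polynomial.order z p"
        using assms(1) ord by (auto simp: order_root)
      thus "z \<in> {z. poly p z = 0}" using False by (simp add: order_root)
    qed
    show "[:-z, 1:] ^ Polynomial.order z q dvd [:-z, 1:] ^ Polynomial.order z p"
      if "z \<in> {z. poly q z = 0}" for z
      using ord that by (intro le_imp_power_dvd) auto
  qed
  hence "Polynomial.smult (lead_coeff q) (\<Prod>z|poly q z = 0. [:-z, 1:] ^ Polynomial.order z q) dvd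
         Polynomial.smult (lead_coeff p) (\<Prod>z|poly p z = 0. [:-z, 1:] ^ Polynomial.order z p)"
    using assms(1) by (simp add: smult_dvd_iff dvd_smult)
  thus ?thesis by (simp only: complex_poly_decompose)
qed simp

text \<open>
  Here \<open>D\<close> is one more than the last index below \<open>n\<close> with a nonzero value, and \<open>0\<close> if there is none.
  It serves to shorten multiplicities until the top coefficient is nonzero.
\<close>

lemma last_nonzero_index:
  fixes c :: "nat \<Rightarrow> 'a::zero"
  shows "\<exists>D\<le>n. (\<forall>l. D \<le> l \<and> l < n \<longrightarrow> c l = 0) \<and> (0 < D \<longrightarrow> c (D - 1) \<noteq> 0)"
proof (induction n)
  case (Suc n)
  show ?case
  proof (cases "c n = 0")
    case True
    with Suc show ?thesis by (metis le_SucI less_SucE)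
  next
    case False
    thus ?thesis by (intro exI[of _ "Suc n"]) auto
  qed
qed simp

text \<open>
  The product of the factors \<open>(z - x\<^sub>j) ^ d\<^sub>j\<close> annihilates, because at \<open>x\<^sub>j\<close> the derivatives of order less
  than \<open>d\<^sub>j\<close> of each of its multiples vanish.
\<close>

lemma annihilates_of_prony_solution:
  assumes dim: "dim_vec \<mu> = 2 * d" and sol: "prony_solution d \<mu> s D x a"
  shows "\<exists>Q. Q \<noteq> 0 \<and> degree Q \<le> d \<and> annihilates \<mu> Q"
proof -
  define Q where "Q = (\<Prod>j=1..s. [:-x j, 1:] ^ D j)"
  have "Q \<noteq> 0" by (simp add: Q_def)
  moreover have "degree Q = (\<Sum>j=1..s. D j)"
    by (simp add: Q_def degree_prod_eq_sum_degree degree_linear_power)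
  hence "degree Q \<le> d" using sol by (simp add: prony_solution_def)
  moreover have "annihilates \<mu> Q"
    unfolding annihilates_def
  proof (intro allI impI)
    fix p assume deg: "degree (p * Q) < dim_vec \<mu>"
    define q where "q = p * Q"
    have q: "q = (\<Sum>k<2*d. Polynomial.smult (coeff q k) (monom 1 k))"
      using deg dim poly_eq_sum_monom[of "2 * d" q] unfolding q_def
      by (simp add: smult_monom coeff_eq_0)
    have vanish: "poly ((pderiv ^^ l) q) (x j) = 0" if "j \<in> {1..s}" "l < D j" for j l
    proof -
      have "[:-x j, 1:] ^ D j dvd q"
        unfolding q_def Q_def using that by (intro dvd_mult dvd_prodI) auto
      thus ?thesis using that by (simp add: linear_power_dvd_iff_derivatives_vanish)
    qed
    have "moment_functional \<mu> q = (\<Sum>k<2*d. coeff q k *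
        (\<Sum>j=1..s. \<Sum>l<D j. a j l * poly ((pderiv ^^ l) (monom 1 k)) (x j)))"
      unfolding moment_functional_def dim
    proof (intro sum.cong refl arg_cong2[of _ _ _ _ "(*)"])
      fix k assume "k \<in> {..<2*d}"
      hence "\<mu> $ k = (\<Sum>j=1..s. \<Sum>l<D j.
           if l \<le> k then fact k / fact (k - l) * a j l * x j ^ (k - l) else 0)"
        using sol by (simp add: prony_solution_def)
      also have "\<dots> = (\<Sum>j=1..s. \<Sum>l<D j. a j l * poly ((pderiv ^^ l) (monom 1 k)) (x j))"
        by (intro sum.cong refl) (simp add: poly_higher_pderiv_monom)
      finally show "\<mu> $ k = \<dots>" .
    qed
    also have "\<dots> = (\<Sum>j=1..s. \<Sum>l<D j. a j l *
        (\<Sum>k<2*d. coeff q k * poly ((pderiv ^^ l) (monom 1 k)) (x j)))"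
    proof -
      let ?F = "\<lambda>k j l. coeff q k * (a j l * poly ((pderiv ^^ l) (monom 1 k)) (x j))"
      have "(\<Sum>k<2*d. \<Sum>j=1..s. \<Sum>l<D j. ?F k j l) = (\<Sum>j=1..s. \<Sum>k<2*d. \<Sum>l<D j. ?F k j l)"
        by (rule sum.swap)
      also have "\<dots> = (\<Sum>j=1..s. \<Sum>l<D j. \<Sum>k<2*d. ?F k j l)"
        by (rule sum.cong[OF refl]) (rule sum.swap)
      finally show ?thesis by (simp add: sum_distrib_left mult_ac)
    qed
    also have "\<dots> = (\<Sum>j=1..s. \<Sum>l<D j. a j l * poly ((pderiv ^^ l) q) (x j))"
      by (subst (2) q) (simp add: higher_pderiv_sum higher_pderiv_smult poly_sum)
    also have "\<dots> = 0" using vanish by (intro sum.neutral ballI) simp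
    finally show "moment_functional \<mu> (p * Q) = 0" by (simp add: q_def)
  qed
  ultimately show ?thesis by blast
qed

text \<open>
  A polynomial in the common kernel of the derivatives below the multiplicities of the roots of \<open>Q\<close>
  is a multiple of \<open>Q\<close>, so the moment functional vanishes there.
\<close>

lemma moments_as_derivatives_at_roots:
  assumes dim: "dim_vec \<mu> = 2 * d" and Q: "Q \<noteq> 0" "annihilates \<mu> Q"
  shows "\<exists>c. \<forall>k<2*d. \<mu> $ k =
           (\<Sum>z | poly Q z = 0. \<Sum>l<Polynomial.order z Q. c z l * poly ((pderiv ^^ l) (monom 1 k)) z)"
proof -
  define R where "R = {z. poly Q z = 0}"
  define I where "I = Sigma R (\<lambda>z. {..<Polynomial.order z Q})"
  define f where "f = (\<lambda>(z, l) p. poly ((pderiv ^^ l) p) z :: complex)"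
  have fin: "finite R" unfolding R_def using Q(1) by (rule poly_roots_finite)
  have "\<exists>c. \<forall>p\<in>{p. degree p < 2 * d}. moment_functional \<mu> p = (\<Sum>i\<in>I. c i * f i p)"
  proof (rule functional_combination_of_common_kernel[where scale = Polynomial.smult])
    show "finite I" using fin by (simp add: I_def)
    show "p + Polynomial.smult c q \<in> {p. degree p < 2 * d}"
      if "q \<in> {p. degree p < 2 * d}" "p \<in> {p. degree p < 2 * d}" for p q :: "complex poly" and c
      using that degree_smult_le[of c q] by (auto intro: degree_add_less)
    show "f i (p + Polynomial.smult c q) = f i p + c * f i q" for i p q c
      by (simp add: f_def higher_pderiv_add higher_pderiv_smult split: prod.splits)
    show "moment_functional \<mu> (p + Polynomial.smult c q)
            = moment_functional \<mu> p + c * moment_functional \<mu> q" for p q c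
      by (simp add: moment_functional_add moment_functional_smult)
    show "moment_functional \<mu> p = 0"
      if p: "p \<in> {p. degree p < 2 * d}" and ker: "\<And>i. i \<in> I \<Longrightarrow> f i p = 0" for p
    proof -
      have "Q dvd p"
      proof (rule complex_poly_dvdI_order[OF Q(1)])
        fix z assume "poly Q z = 0"
        thus "[:-z, 1:] ^ Polynomial.order z Q dvd p"
          using ker[of "(z, l)" for l]
          by (auto simp: linear_power_dvd_iff_derivatives_vanish I_def R_def f_def)
      qed
      then obtain t where "p = t * Q" by (metis dvd_def mult.commute)
      thus ?thesis using Q(2) p dim by (simp add: annihilates_def)
    qed
  qed
  then obtain c where c: "\<forall>p\<in>{p. degree p < 2 * d}. moment_functional \<mu> p = (\<Sum>i\<in>I. c i * f i p)" ..
  have "\<mu> $ k = (\<Sum>z\<in>R. \<Sum>l<Polynomial.order z Q. c (z, l) * poly ((pderiv ^^ l) (monom 1 k)) z)"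
    if k: "k < 2 * d" for k
  proof -
    have "\<mu> $ k = moment_functional \<mu> (monom 1 k)"
      using k dim by (simp add: moment_functional_monom)
    also have "\<dots> = (\<Sum>i\<in>I. c i * f i (monom 1 k))"
      using c k by (simp add: degree_monom_eq)
    also have "\<dots> = (\<Sum>z\<in>R. \<Sum>l<Polynomial.order z Q. c (z, l) * f (z, l) (monom 1 k))"
      unfolding I_def using fin by (subst sum.Sigma) auto
    finally show ?thesis by (simp add: f_def)
  qed
  thus ?thesis unfolding R_def by (intro exI[of _ "\<lambda>z l. c (z, l)"]) simp
qed

text \<open>
  The orders of the roots of \<open>Q\<close> are only upper bounds for the multiplicities of a solution. Each one
  is cut down to the last nonzero coefficient, and roots without any nonzero coefficient are no nodes.
\<close>

lemma prony_solvable_of_annihilator: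
  assumes dim: "dim_vec \<mu> = 2 * d" and Q: "Q \<noteq> 0" "degree Q \<le> d" "annihilates \<mu> Q"
  shows "prony_solvable d \<mu>"
proof -
  define R where "R = {z. poly Q z = 0}"
  have fin: "finite R" unfolding R_def using Q(1) by (rule poly_roots_finite)
  obtain c where c: "\<And>k. k < 2 * d \<Longrightarrow> \<mu> $ k =
      (\<Sum>z\<in>R. \<Sum>l<Polynomial.order z Q. c z l * poly ((pderiv ^^ l) (monom 1 k)) z)"
    using moments_as_derivatives_at_roots[OF dim Q(1,3)] unfolding R_def by blast
  have "\<forall>z. \<exists>D\<le>Polynomial.order z Q. (\<forall>l. D \<le> l \<and> l < Polynomial.order z Q \<longrightarrow> c z l = 0) \<and>
              (0 < D \<longrightarrow> c z (D - 1) \<noteq> 0)"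
    by (intro allI last_nonzero_index)
  then obtain D where D: "\<And>z. D z \<le> Polynomial.order z Q"
    "\<And>z l. D z \<le> l \<Longrightarrow> l < Polynomial.order z Q \<Longrightarrow> c z l = 0"
    "\<And>z. 0 < D z \<Longrightarrow> c z (D z - 1) \<noteq> 0"
    by metis
  define X where "X = {z \<in> R. 0 < D z}"
  have finX: "finite X" using fin by (simp add: X_def)
  then obtain x where x: "bij_betw x {1..card X} X"
    using ex_bij_betw_nat_finite_1 by blast
  have "prony_solution d \<mu> (card X) (\<lambda>j. D (x j)) x (\<lambda>j. c (x j))"
    unfolding prony_solution_def
  proof (intro conjI ballI allI impI)
    fix j assume "j \<in> {1..card X}"
    hence pos: "0 < D (x j)" using bij_betwE[OF x] by (auto simp: X_def)
    show "0 < D (x j)" by (fact pos)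
    show "c (x j) (D (x j) - 1) \<noteq> 0" using pos by (rule D(3))
  next
    have "(\<Sum>j=1..card X. D (x j)) = (\<Sum>z\<in>X. D z)"
      using x by (rule sum.reindex_bij_betw)
    also have "\<dots> \<le> (\<Sum>z\<in>R. D z)"
      using fin by (intro sum_mono2) (auto simp: X_def)
    also have "\<dots> \<le> (\<Sum>z\<in>R. Polynomial.order z Q)"
      by (intro sum_mono D(1))
    also have "\<dots> \<le> degree Q"
      unfolding R_def using Q(1) by (rule sum_order_le_degree)
    finally show "(\<Sum>j=1..card X. D (x j)) \<le> d" using Q(2) by simp
  next
    show "inj_on x {1..card X}" using x by (rule bij_betw_imp_inj_on)
  next
    fix k assume k: "k < 2 * d"
    let ?f = "\<lambda>z l. c z l * poly ((pderiv ^^ l) (monom 1 k)) z"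
    have "(\<Sum>j=1..card X. \<Sum>l<D (x j).
             if l \<le> k then fact k / fact (k - l) * c (x j) l * x j ^ (k - l) else 0) =
          (\<Sum>j=1..card X. \<Sum>l<D (x j). ?f (x j) l)"
      by (intro sum.cong refl) (simp add: poly_higher_pderiv_monom)
    also have "\<dots> = (\<Sum>z\<in>X. \<Sum>l<D z. ?f z l)"
      using x by (rule sum.reindex_bij_betw)
    also have "\<dots> = (\<Sum>z\<in>R. \<Sum>l<D z. ?f z l)"
      using fin by (intro sum.mono_neutral_left) (auto simp: X_def)
    also have "\<dots> = (\<Sum>z\<in>R. \<Sum>l<Polynomial.order z Q. ?f z l)"
      by (intro sum.cong refl sum.mono_neutral_left) (use D(1,2) in \<open>auto intro: less_le_trans\<close>)
    also have "\<dots> = \<mu> $ k" using c[OF k] by simp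
    finally show "(\<Sum>j=1..card X. \<Sum>l<D (x j).
        if l \<le> k then fact k / fact (k - l) * c (x j) l * x j ^ (k - l) else 0) = \<mu> $ k" .
  qed
  thus ?thesis unfolding prony_solvable_def by blast
qed

lemma prony_solvable_iff_annihilator:
  assumes "dim_vec \<mu> = 2 * d"
  shows "prony_solvable d \<mu> \<longleftrightarrow> (\<exists>Q. Q \<noteq> 0 \<and> degree Q \<le> d \<and> annihilates \<mu> Q)"
  using prony_solvable_of_annihilator[OF assms] annihilates_of_prony_solution[OF assms]
  unfolding prony_solvable_def by blast

section \<open>Solvable and unsolvable right-hand sides\<close>

theorem corollary1:
  fixes d :: nat
  shows "solvable_set d = insert (0\<^sub>v (2*d)) (\<Union>r\<in>{1..d}. Sigma_rank d r) \<and>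
         unsolvable_set d = (\<Union>r\<in>{1..d}. Sigma'_rank d r) \<and>
         unsolvable_set d \<subseteq> {\<mu> \<in> carrier_vec (2*d). det (hankel_minor d \<mu>) = 0}"
proof -
  let ?rank = "\<lambda>\<mu>. vec_space.rank d (hankel_rect d \<mu>)"
  have solvable_iff: "prony_solvable d \<mu> \<longleftrightarrow> det (hankel_minor (?rank \<mu>) \<mu>) \<noteq> 0"
    if "\<mu> \<in> carrier_vec (2 * d)" for \<mu>
    using that by (simp add: prony_solvable_iff_annihilator annihilator_exists_iff rank_hankel_le)
  have minor_0: "det (hankel_minor 0 \<mu>) \<noteq> 0" for \<mu>
    by (simp add: hankel_minor_def)
  have zero: "?rank \<mu> = 0 \<longleftrightarrow> \<mu> = 0\<^sub>v (2 * d)" if "\<mu> \<in> carrier_vec (2 * d)" for \<mu>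
    using that by (rule rank_hankel_0_iff)
  have range: "?rank \<mu> \<in> {1..d}" if "?rank \<mu> \<noteq> 0" for \<mu>
    using that rank_hankel_le[of d \<mu>] by simp
  have "solvable_set d = insert (0\<^sub>v (2*d)) (\<Union>r\<in>{1..d}. Sigma_rank d r)"
  proof (intro equalityI subsetI)
    fix \<mu> assume "\<mu> \<in> solvable_set d"
    hence \<mu>: "\<mu> \<in> carrier_vec (2 * d)" "det (hankel_minor (?rank \<mu>) \<mu>) \<noteq> 0"
      using solvable_iff by (auto simp: solvable_set_def)
    show "\<mu> \<in> insert (0\<^sub>v (2*d)) (\<Union>r\<in>{1..d}. Sigma_rank d r)"
    proof (cases "?rank \<mu> = 0")
      case True thus ?thesis using zero \<mu> by simp
    next
      case False
      have "\<mu> \<in> Sigma_rank d (?rank \<mu>)" using \<mu> by (simp add: Sigma_rank_def)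
      thus ?thesis using range[OF False] by blast
    qed
  next
    fix \<mu> assume "\<mu> \<in> insert (0\<^sub>v (2*d)) (\<Union>r\<in>{1..d}. Sigma_rank d r)"
    thus "\<mu> \<in> solvable_set d"
    proof
      assume [simp]: "\<mu> = 0\<^sub>v (2*d)"
      have "?rank \<mu> = 0" using zero by simp
      thus ?thesis using solvable_iff[of \<mu>] minor_0[of \<mu>] by (simp add: solvable_set_def)
    next
      assume "\<mu> \<in> (\<Union>r\<in>{1..d}. Sigma_rank d r)"
      thus ?thesis by (auto simp: solvable_set_def Sigma_rank_def solvable_iff)
    qed
  qed
  moreover have "unsolvable_set d = (\<Union>r\<in>{1..d}. Sigma'_rank d r)"
  proof (intro equalityI subsetI)
    fix \<mu> assume "\<mu> \<in> unsolvable_set d"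
    hence \<mu>: "\<mu> \<in> carrier_vec (2 * d)" "det (hankel_minor (?rank \<mu>) \<mu>) = 0"
      using solvable_iff by (auto simp: unsolvable_set_def)
    have "?rank \<mu> \<noteq> 0" using \<mu>(2) minor_0[of \<mu>] by metis
    moreover have "\<mu> \<in> Sigma'_rank d (?rank \<mu>)" using \<mu> by (simp add: Sigma'_rank_def)
    ultimately show "\<mu> \<in> (\<Union>r\<in>{1..d}. Sigma'_rank d r)" using range by blast
  next
    fix \<mu> assume "\<mu> \<in> (\<Union>r\<in>{1..d}. Sigma'_rank d r)"
    thus "\<mu> \<in> unsolvable_set d"
      by (auto simp: unsolvable_set_def Sigma'_rank_def solvable_iff)
  qed
  moreover have "unsolvable_set d \<subseteq> {\<mu> \<in> carrier_vec (2*d). det (hankel_minor d \<mu>) = 0}"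
  proof
    fix \<mu> assume "\<mu> \<in> unsolvable_set d"
    hence \<mu>: "\<mu> \<in> carrier_vec (2 * d)" "det (hankel_minor (?rank \<mu>) \<mu>) = 0"
      using solvable_iff by (auto simp: unsolvable_set_def)
    have "?rank \<mu> = d" if "det (hankel_minor d \<mu>) \<noteq> 0"
      using rank_hankel_ge[OF order_refl that] rank_hankel_le[of d \<mu>] by simp
    thus "\<mu> \<in> {\<mu> \<in> carrier_vec (2*d). det (hankel_minor d \<mu>) = 0}" using \<mu> by force
  qed
  ultimately show ?thesis by blast
qed

end
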